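(* Let $A_1,\dots,A_m\in\mathbb{S}^n$ be such that $\mathbf{A}=[\mathrm{vec}\,A_1,\dots,\mathrm{vec}\,A_m]\in\mathbb{R}^{n^2\times m}$ has linearly independent columns. Let $W=W_0+UU^T$ with $W_0\in\mathbb{S}^n_{++}$ and $U\in\mathbb{R}^{n\times k}$, and let $Z$ be any real matrix satisfying $ZZ^T=2W_0+UU^T$. Define $$\mathbf{H}=\mathbf{A}^T(W\otimes W)\mathbf{A},\qquad \mathbf{U}=\mathbf{A}^T(U\otimes Z),\qquad \tilde{\mathbf{H}}=\tau^2\mathbf{A}^T\mathbf{A}+\mathbf{U}\mathbf{U}^T,$$ where $\tau$ satisfies $\lambda_{\min}(W_0)\le\tau\le\lambda_{\max}(W_0)$. Then $\kappa(\mathbf{H},\tilde{\mathbf{H}})\le\kappa^2(W_0)$.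
   Context: $\mathbb{S}^n$ denotes the real symmetric $n\times n$ matrices and $\mathbb{S}^n_{++}$ the positive definite ones. For a positive definite matrix $M$, $\kappa(M)=\lambda_{\max}(M)/\lambda_{\min}(M)$; for positive definite $M,N$ of the same size, $\kappa(M,N)=\kappa(N^{-1/2}MN^{-1/2})$. $\mathrm{vec}$ and $\otimes$ are the (nonsymmetricized) vectorization and Kronecker product with the convention $\mathrm{vec}(AXB^T)=(A\otimes B)\,\mathrm{vec}\,X$. $\kappa^2(W_0)$ means $(\kappa(W_0))^2$. *)

theory Defs
  imports "HOL-Analysis.Analysis"
begin

definition sym_mat :: "real^'n^'n \<Rightarrow> bool" where
  "sym_mat M \<longleftrightarrow> transpose M = M"

definition pos_def :: "real^'n^'n \<Rightarrow> bool" where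
  "pos_def M \<longleftrightarrow> sym_mat M \<and> (\<forall>x. x \<noteq> 0 \<longrightarrow> 0 < x \<bullet> (M *v x))"

definition eigenvalues :: "real^'n^'n \<Rightarrow> real set" where
  "eigenvalues M = {c. \<exists>v. v \<noteq> 0 \<and> M *v v = c *s v}"

text \<open>The set of eigenvalues is finite, and for symmetric matrices it is nonempty, so that
  the maximum and minimum below are attained.\<close>

definition lambda_max :: "real^'n^'n \<Rightarrow> real" where
  "lambda_max M = Max (eigenvalues M)"

definition lambda_min :: "real^'n^'n \<Rightarrow> real" where
  "lambda_min M = Min (eigenvalues M)"

definition cond_num :: "real^'n^'n \<Rightarrow> real" where
  "cond_num M = lambda_max M / lambda_min M"

text \<open>A positive definite matrix has exactly one positive definite square root. The
  definitions from here to \<open>rel_cond_num\<close> are meant for positive definite arguments only.\<close>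

definition pd_sqrt :: "real^'n^'n \<Rightarrow> real^'n^'n" where
  "pd_sqrt N = (THE S. pos_def S \<and> S ** S = N)"

definition pd_inv_sqrt :: "real^'n^'n \<Rightarrow> real^'n^'n" where
  "pd_inv_sqrt N = matrix_inv (pd_sqrt N)"

definition rel_cond_num :: "real^'n^'n \<Rightarrow> real^'n^'n \<Rightarrow> real" where
  "rel_cond_num M N = cond_num (pd_inv_sqrt N ** M ** pd_inv_sqrt N)"

text \<open>Vectors of length \<open>m n\<close> are indexed by pairs of indices. The index order of \<open>kron\<close> and
  \<open>vectorize\<close> is fixed by the identity \<open>vec (A X B\<^sup>T) = (A \<otimes> B) vec X\<close>, proved below.\<close>

definition vectorize :: "real^'n^'m \<Rightarrow> real^('m \<times> 'n)" where
  "vectorize X = (\<chi> p. X $ fst p $ snd p)"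

definition kron :: "real^'n^'m \<Rightarrow> real^'q^'p \<Rightarrow> real^('n \<times> 'q)^('m \<times> 'p)"
    (infixl "\<otimes>\<^sub>K" 75) where
  "A \<otimes>\<^sub>K B = (\<chi> r c. A $ fst r $ fst c * B $ snd r $ snd c)"

lemma vectorize_kron:
  "vectorize (A ** X ** transpose B) = (A \<otimes>\<^sub>K B) *v vectorize X"
proof -
  have "(\<Sum>l\<in>UNIV. (\<Sum>k\<in>UNIV. A $ i $ k * X $ k $ l) * B $ j $ l) =
      (\<Sum>k\<in>UNIV. \<Sum>l\<in>UNIV. A $ i $ k * B $ j $ l * X $ k $ l)" for i j
    by (subst sum.swap) (simp add: sum_distrib_left mult_ac)
  then show ?thesis
    by (simp add: vec_eq_iff vectorize_def kron_def matrix_vector_mult_def matrix_matrix_mult_def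
        transpose_def sum.cartesian_product case_prod_unfold)
qed

definition vec_columns :: "('m \<Rightarrow> real^'n^'n) \<Rightarrow> real^'m^('n \<times> 'n)" where
  "vec_columns A = (\<chi> r j. vectorize (A j) $ r)"

text \<open>Independence of the columns as an indexed family, so repeated columns are excluded
  (unlike independence of the set \<open>columns M\<close>).\<close>

definition lin_indep_columns :: "real^'m^'d \<Rightarrow> bool" where
  "lin_indep_columns M \<longleftrightarrow>
     (\<forall>c. (\<Sum>j\<in>UNIV. c j *s column j M) = 0 \<longrightarrow> (\<forall>j. c j = 0))"

end

theory Submission
  imports Defs
begin

text \<open>For \<open>v\<close> in \<open>\<real>\<^sup>m\<close> put \<open>X = \<Sum>\<^sub>i v\<^sub>i A\<^sub>i\<close>, a symmetric matrix. Since \<open>X\<close> is symmetric, the two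
  mixed terms of \<open>\<langle>X, W X W\<rangle>\<close> coincide, so the quadratic form of \<open>H\<close> at \<open>v\<close> is
  \<open>\<langle>X, W\<^sub>0 X W\<^sub>0\<rangle> + s\<close> with \<open>s = \<langle>X, U U\<^sup>T X Z Z\<^sup>T\<rangle> \<ge> 0\<close>, while that of \<open>H'\<close> is \<open>\<tau>\<^sup>2 \<parallel>X\<parallel>\<^sup>2 + s\<close>.
  As \<open>\<langle>X, W\<^sub>0 X W\<^sub>0\<rangle>\<close> lies between \<open>\<lambda>\<^sub>m\<^sub>i\<^sub>n\<^sup>2 \<parallel>X\<parallel>\<^sup>2\<close> and \<open>\<lambda>\<^sub>m\<^sub>a\<^sub>x\<^sup>2 \<parallel>X\<parallel>\<^sup>2\<close>, and
  \<open>\<lambda>\<^sub>m\<^sub>i\<^sub>n / \<tau> \<le> 1 \<le> \<lambda>\<^sub>m\<^sub>a\<^sub>x / \<tau>\<close>, the matrix \<open>H\<close> lies between \<open>(\<lambda>\<^sub>m\<^sub>i\<^sub>n / \<tau>)\<^sup>2 H'\<close> and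
  \<open>(\<lambda>\<^sub>m\<^sub>a\<^sub>x / \<tau>)\<^sup>2 H'\<close> in the Loewner order.\<close>

section \<open>Eigenbases of symmetric matrices\<close>

lemma inner_transpose_matrix_vector:
  fixes M :: "real^'n^'m"
  shows "(transpose M *v x) \<bullet> y = x \<bullet> (M *v y)"
  by (simp add: dot_lmul_matrix)

lemma sym_mat_inner:
  assumes "sym_mat M"
  shows "(M *v x) \<bullet> y = x \<bullet> (M *v y)"
  by (metis assms inner_transpose_matrix_vector sym_mat_def)

text \<open>First-order condition at an extremum: for small \<open>t\<close> a nonzero linear term
  dominates the quadratic one, and a suitable sign of \<open>t\<close> makes the whole
  negative.\<close>

lemma nonneg_quadratic_linear_coeff:
  fixes p q :: real
  assumes "\<And>t. 0 \<le> 2 * t * p + t\<^sup>2 * q"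
  shows "p = 0"
proof (rule ccontr)
  assume "p \<noteq> 0"
  \<comment> \<open>\<open>e\<close> is positive and at least \<open>q\<close>; the point
    \<open>t = - p / e\<close> minimises \<open>2 * t * p + t\<^sup>2 * e\<close>.\<close>
  define e where "e = \<bar>q\<bar> + 1"
  define t where "t = - p / e"
  have d: "e > 0" by (simp add: e_def)
  have "2 * t * p + t\<^sup>2 * q \<le> 2 * t * p + t\<^sup>2 * e"
    by (intro add_left_mono mult_left_mono) (auto simp: e_def)
  also have "\<dots> = - (p\<^sup>2 / e)"
    using d unfolding t_def by (simp add: field_simps power2_eq_square)
  also have "\<dots> < 0"
    using d \<open>p \<noteq> 0\<close> by simp
  finally show False
    using assms[of t] by simp
qed

text \<open>A maximiser of the Rayleigh quotient on the unit sphere of \<open>V\<close> is an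
  eigenvector. Working inside an invariant \<open>V\<close> allows a system of eigenvectors to be
  extended within its orthogonal complement.\<close>

lemma sym_mat_eigenvector_in_subspace:
  fixes M :: "real^'n^'n"
  assumes sym: "sym_mat M" and V: "subspace V" and inv: "\<And>x. x \<in> V \<Longrightarrow> M *v x \<in> V"
    and w: "w \<in> V" "w \<noteq> 0"
  obtains v c where "v \<in> V" "norm v = 1" "M *v v = c *\<^sub>R v"
proof -
  let ?K = "V \<inter> sphere 0 1"
  have "compact ?K"
    by (simp add: V closed_Int_compact closed_subspace)
  moreover have "w /\<^sub>R norm w \<in> ?K"
    using w V by (simp add: subspace_scale)
  moreover have "continuous_on ?K (\<lambda>x. x \<bullet> (M *v x))"
    by (intro continuous_intros matrix_vector_mult_linear_continuous_on)
  ultimately obtain v where v: "v \<in> ?K" and max: "\<And>y. y \<in> ?K \<Longrightarrow> y \<bullet> (M *v y) \<le> v \<bullet> (M *v v)"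
    using continuous_attains_sup[of ?K "\<lambda>x. x \<bullet> (M *v x)"] by blast
  define c where "c = v \<bullet> (M *v v)"
  have vV: "v \<in> V" and nv: "norm v = 1" and vv: "v \<bullet> v = 1"
    using v by (auto simp: norm_eq_1)
  have bound: "y \<bullet> (M *v y) \<le> c * (y \<bullet> y)" if "y \<in> V" for y
  proof (cases "y = 0")
    case False
    then have "y /\<^sub>R norm y \<in> ?K"
      using that V by (simp add: subspace_scale)
    from max[OF this] have "y \<bullet> (M *v y) / (norm y)\<^sup>2 \<le> c"
      by (simp add: c_def matrix_vector_mult_scaleR power2_eq_square field_simps)
    then show ?thesis
      using False by (simp add: field_simps dot_square_norm)
  qed simp
  \<comment> \<open>Invariance keeps this residual in \<open>V\<close>, so \<open>v\<close> may be
    varied along \<open>z\<close>; the linear coefficient of that variation is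
    \<open>2 * (z \<bullet> z)\<close>.\<close>
  define z where "z = c *\<^sub>R v - M *v v"
  have zV: "z \<in> V"
    unfolding z_def using V vV inv by (simp add: subspace_diff subspace_scale)
  have "0 \<le> 2 * t * (z \<bullet> z) + t\<^sup>2 * (c * (z \<bullet> z) - z \<bullet> (M *v z))" for t
  proof -
    have "v + t *\<^sub>R z \<in> V"
      using V vV zV by (simp add: subspace_add subspace_scale)
    from bound[OF this]
    have "0 \<le> 2 * t * (c * (v \<bullet> z) - z \<bullet> (M *v v)) + t\<^sup>2 * (c * (z \<bullet> z) - z \<bullet> (M *v z))"
      using sym_mat_inner[OF sym, of v z]
      by (simp add: inner_simps matrix_vector_right_distrib matrix_vector_mult_scaleR vv
          c_def[symmetric] inner_commute power2_eq_square algebra_simps)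
    moreover have "c * (v \<bullet> z) - z \<bullet> (M *v v) = z \<bullet> z"
      by (simp add: z_def inner_simps inner_commute algebra_simps)
    ultimately show ?thesis by simp
  qed
  then have "z \<bullet> z = 0"
    by (rule nonneg_quadratic_linear_coeff)
  then show thesis
    using that[OF vV nv, of c] by (simp add: z_def)
qed

text \<open>The eigenvectors index themselves and \<open>c\<close> need not be injective on
  \<open>B\<close>, so multiplicities are kept. Completeness is encoded as the expansion
  formula.\<close>

definition eigenbasis :: "real^'n^'n \<Rightarrow> (real^'n) set \<Rightarrow> (real^'n \<Rightarrow> real) \<Rightarrow> bool" where
  "eigenbasis M B c \<longleftrightarrow> finite B \<and> (\<forall>a\<in>B. \<forall>b\<in>B. a \<bullet> b = (if a = b then 1 else 0)) \<and>
     (\<forall>x. x = (\<Sum>b\<in>B. (b \<bullet> x) *\<^sub>R b)) \<and> (\<forall>b\<in>B. M *v b = c b *\<^sub>R b)"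

lemma inner_sum_orthonormal:
  assumes "finite B" "\<And>a b. a \<in> B \<Longrightarrow> b \<in> B \<Longrightarrow> a \<bullet> b = (if a = b then 1 else 0)" "a \<in> B"
  shows "a \<bullet> (\<Sum>b\<in>B. f b *\<^sub>R b) = f a"
proof -
  have "a \<bullet> (\<Sum>b\<in>B. f b *\<^sub>R b) = (\<Sum>b\<in>B. if a = b then f b else 0)"
    unfolding inner_sum_right by (rule sum.cong) (simp_all add: assms)
  then show ?thesis
    using assms by simp
qed

text \<open>Spectral theorem: take an orthonormal set of eigenvectors of greatest cardinality. By
  symmetry its orthogonal complement is invariant, so a nonzero vector there would yield one more
  eigenvector.\<close>

lemma eigenbasis_exists:
  fixes M :: "real^'n^'n"
  assumes sym: "sym_mat M"
  obtains B c where "eigenbasis M B c"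
proof -
  define P where "P B \<longleftrightarrow> finite B \<and> (\<forall>a\<in>B. \<forall>b\<in>B. a \<bullet> b = (if a = b then 1 else 0)) \<and>
     (\<forall>b\<in>B. \<exists>c. M *v b = c *\<^sub>R b)" for B
  have "P {}" by (simp add: P_def)
  moreover have "card B \<le> CARD('n)" if "P B" for B
  proof -
    have "pairwise orthogonal B"
      using that by (auto simp: P_def pairwise_def orthogonal_def)
    moreover have "0 \<notin> B"
      using that by (force simp: P_def)
    ultimately have "independent B"
      by (rule pairwise_orthogonal_independent)
    from independent_bound[OF this] show ?thesis by simp
  qed
  ultimately obtain B where PB: "P B" and max: "\<And>C. P C \<Longrightarrow> card C \<le> card B"
    using ex_has_greatest_nat[of P "{}" card "Suc CARD('n)"] by (metis less_Suc_eq_le)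
  have fin: "finite B" and on: "\<And>a b. a \<in> B \<Longrightarrow> b \<in> B \<Longrightarrow> a \<bullet> b = (if a = b then 1 else 0)"
    and "\<forall>b\<in>B. \<exists>c. M *v b = c *\<^sub>R b"
    using PB by (auto simp: P_def)
  then obtain c where c: "\<And>b. b \<in> B \<Longrightarrow> M *v b = c b *\<^sub>R b" by metis
  define V where "V = {x. \<forall>b\<in>B. b \<bullet> x = 0}"
  have V: "subspace V"
    by (auto simp: V_def subspace_def inner_simps)
  have inv: "M *v x \<in> V" if "x \<in> V" for x
    using that c by (auto simp: V_def sym_mat_inner[OF sym, symmetric])
  have V0: "w = 0" if w: "w \<in> V" for w
  proof (rule ccontr)
    assume "w \<noteq> 0"
    from sym_mat_eigenvector_in_subspace[OF sym V inv w this]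
    obtain v d where v: "v \<in> V" "norm v = 1" "M *v v = d *\<^sub>R v" by blast
    have "v \<notin> B"
      using v by (auto simp: V_def norm_eq_1)
    have "P (insert v B)"
      using PB v \<open>v \<notin> B\<close> by (auto simp: P_def V_def norm_eq_1 inner_commute)
    from max[OF this] show False
      using fin \<open>v \<notin> B\<close> by simp
  qed
  have "x = (\<Sum>b\<in>B. (b \<bullet> x) *\<^sub>R b)" for x
    using V0[of "x - (\<Sum>b\<in>B. (b \<bullet> x) *\<^sub>R b)"] inner_sum_orthonormal[OF fin on]
    by (simp add: V_def inner_diff_right)
  then have "eigenbasis M B c"
    using fin on c by (auto simp: eigenbasis_def)
  then show thesis by (rule that)
qed

context
  fixes M :: "real^'n^'n" and B c
  assumes eb: "eigenbasis M B c"
begin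

lemma eigenbasis_finite: "finite B"
  and eigenbasis_orthonormal: "\<lbrakk>a \<in> B; b \<in> B\<rbrakk> \<Longrightarrow> a \<bullet> b = (if a = b then 1 else 0)"
  and eigenbasis_eigen: "b \<in> B \<Longrightarrow> M *v b = c b *\<^sub>R b"
  using eb by (auto simp: eigenbasis_def)

lemma eigenbasis_expand: "(\<Sum>b\<in>B. (b \<bullet> x) *\<^sub>R b) = x"
  using eb unfolding eigenbasis_def by metis

lemma eigenbasis_apply: "M *v x = (\<Sum>b\<in>B. (c b * (b \<bullet> x)) *\<^sub>R b)"
proof -
  have "M *v x = M *v (\<Sum>b\<in>B. (b \<bullet> x) *\<^sub>R b)"
    by (simp add: eigenbasis_expand)
  also have "\<dots> = (\<Sum>b\<in>B. (b \<bullet> x) *\<^sub>R (M *v b))"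
    by (simp add: linear_sum[OF matrix_vector_mul_linear] o_def matrix_vector_mult_scaleR)
  also have "\<dots> = (\<Sum>b\<in>B. (c b * (b \<bullet> x)) *\<^sub>R b)"
    by (intro sum.cong) (auto simp: eigenbasis_eigen)
  finally show ?thesis .
qed

lemma eigenbasis_form: "x \<bullet> (M *v x) = (\<Sum>b\<in>B. c b * (b \<bullet> x)\<^sup>2)"
  by (simp add: eigenbasis_apply inner_sum_right power2_eq_square inner_commute mult_ac)

lemma eigenbasis_norm: "x \<bullet> x = (\<Sum>b\<in>B. (b \<bullet> x)\<^sup>2)"
proof -
  have "x \<bullet> x = x \<bullet> (\<Sum>b\<in>B. (b \<bullet> x) *\<^sub>R b)"
    by (simp add: eigenbasis_expand)
  then show ?thesis
    by (simp add: inner_sum_right power2_eq_square inner_commute)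
qed

lemma eigenbasis_nonzero_component:
  assumes "x \<noteq> 0"
  obtains b where "b \<in> B" "b \<bullet> x \<noteq> 0"
proof -
  have "(\<Sum>b\<in>B. (b \<bullet> x)\<^sup>2) \<noteq> 0"
    using assms by (simp add: eigenbasis_norm[symmetric])
  then show thesis
    using that by (metis (no_types, lifting) sum.neutral zero_power2)
qed

text \<open>An empty \<open>B\<close> would give every vector norm 0, yet a coordinate vector has
  norm 1.\<close>

lemma eigenbasis_nonempty: "B \<noteq> {}"
  using eigenbasis_norm[of "axis undefined 1"] by (auto simp: inner_axis_axis)

lemma eigenbasis_eigenvalues: "eigenvalues M = c ` B"
proof (intro equalityI subsetI)
  fix d assume "d \<in> eigenvalues M"
  then obtain v where v: "v \<noteq> 0" "M *v v = d *\<^sub>R v"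
    by (auto simp: eigenvalues_def scalar_mult_eq_scaleR)
  \<comment> \<open>Pairing the eigenvector equation with a basis vector not orthogonal to
    \<open>v\<close> forces \<open>d = c b\<close>.\<close>
  then obtain b where b: "b \<in> B" "b \<bullet> v \<noteq> 0"
    using eigenbasis_nonzero_component by blast
  have "d * (b \<bullet> v) = b \<bullet> (M *v v)"
    by (simp add: v)
  also have "\<dots> = c b * (b \<bullet> v)"
    unfolding eigenbasis_apply
    by (rule inner_sum_orthonormal[OF eigenbasis_finite eigenbasis_orthonormal b(1)])
  finally show "d \<in> c ` B"
    using b by auto
next
  fix d assume "d \<in> c ` B"
  then obtain b where b: "b \<in> B" "d = c b" by auto
  then have "b \<noteq> 0"
    using eigenbasis_orthonormal[of b b] by auto
  then show "d \<in> eigenvalues M"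
    using b eigenbasis_eigen by (auto simp: eigenvalues_def scalar_mult_eq_scaleR)
qed

end

lemma sym_mat_eigenvalues:
  assumes "sym_mat M"
  shows "finite (eigenvalues M)" "eigenvalues M \<noteq> {}"
  using eigenbasis_exists[OF assms] eigenbasis_eigenvalues eigenbasis_finite eigenbasis_nonempty
  by (metis finite_imageI, metis image_is_empty)

text \<open>In an eigenbasis the form and the squared norm are sums of the same squares, with
  eigenvalues as weights in the former.\<close>

lemma lambda_bounds:
  assumes "sym_mat M"
  shows "lambda_min M * (x \<bullet> x) \<le> x \<bullet> (M *v x)" "x \<bullet> (M *v x) \<le> lambda_max M * (x \<bullet> x)"
proof -
  obtain B c where eb: "eigenbasis M B c"
    using eigenbasis_exists[OF assms] .
  have "lambda_min M \<le> c b" "c b \<le> lambda_max M" if "b \<in> B" for b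
    using that eigenbasis_finite[OF eb]
    by (auto simp: lambda_min_def lambda_max_def eigenbasis_eigenvalues[OF eb])
  then show "lambda_min M * (x \<bullet> x) \<le> x \<bullet> (M *v x)" "x \<bullet> (M *v x) \<le> lambda_max M * (x \<bullet> x)"
    by (auto simp: eigenbasis_form[OF eb] eigenbasis_norm[OF eb] sum_distrib_left
        intro!: sum_mono mult_right_mono)
qed

lemma pos_def_eigenvalue_pos:
  assumes "pos_def M" "d \<in> eigenvalues M"
  shows "0 < d"
proof -
  obtain v where v: "v \<noteq> 0" "M *v v = d *\<^sub>R v"
    using assms(2) by (auto simp: eigenvalues_def scalar_mult_eq_scaleR)
  then have "0 < d * (v \<bullet> v)"
    using assms(1) by (metis inner_scaleR_right pos_def_def)
  then show ?thesis
    using v by (metis inner_gt_zero_iff zero_less_mult_pos2)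
qed

lemma lambda_min_pos:
  assumes "pos_def M"
  shows "0 < lambda_min M"
  using assms Min_in sym_mat_eigenvalues
  by (metis lambda_min_def pos_def_def pos_def_eigenvalue_pos)

section \<open>Square roots and relative condition numbers\<close>

lemma sym_matI:
  fixes M :: "real^'n^'n"
  assumes "\<And>x y. (M *v x) \<bullet> y = x \<bullet> (M *v y)"
  shows "sym_mat M"
proof -
  have "transpose M *v x = M *v x" for x
    by (rule vector_eq_ldot[THEN iffD1])
      (metis assms inner_commute inner_transpose_matrix_vector)
  then show ?thesis
    by (simp add: sym_mat_def matrix_eq)
qed

text \<open>The root keeps the eigenbasis of \<open>N\<close> and replaces each eigenvalue by its
  square root.\<close>

lemma pd_sqrt_exists:
  fixes N :: "real^'n^'n"
  assumes N: "pos_def N"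
  obtains S where "pos_def S" "S ** S = N"
proof -
  obtain B c where eb: "eigenbasis N B c"
    using eigenbasis_exists N pos_def_def by metis
  note fin = eigenbasis_finite[OF eb] and on = eigenbasis_orthonormal[OF eb]
  have c: "0 < c b" if "b \<in> B" for b
    using that pos_def_eigenvalue_pos[OF N] by (auto simp: eigenbasis_eigenvalues[OF eb])
  define f where "f x = (\<Sum>b\<in>B. (sqrt (c b) * (b \<bullet> x)) *\<^sub>R b)" for x
  have lin: "linear f"
    by (rule linearI)
      (simp_all add: f_def inner_simps algebra_simps sum.distrib scaleR_sum_right)
  define S where "S = matrix f"
  have S: "S *v x = f x" for x
    by (simp add: S_def matrix_works lin)
  have "sym_mat S"
    by (rule sym_matI)
      (simp add: S f_def inner_sum_left inner_sum_right inner_commute mult_ac)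
  moreover have "0 < x \<bullet> (S *v x)" if x: "x \<noteq> 0" for x
  proof -
    obtain b where b: "b \<in> B" "b \<bullet> x \<noteq> 0"
      using eigenbasis_nonzero_component[OF eb x] .
    have "0 < (\<Sum>b\<in>B. sqrt (c b) * (b \<bullet> x)\<^sup>2)"
      using b c by (intro sum_pos2[OF fin b(1)]) (auto simp: less_imp_le)
    then show ?thesis
      by (simp add: S f_def inner_sum_right power2_eq_square inner_commute mult_ac)
  qed
  ultimately have "pos_def S"
    by (simp add: pos_def_def)
  moreover have "S ** S = N"
  proof -
    have "S *v (S *v x) = N *v x" for x
    proof -
      have "b \<bullet> f x = sqrt (c b) * (b \<bullet> x)" if "b \<in> B" for b
        unfolding f_def by (rule inner_sum_orthonormal[OF fin on that])
      then have "f (f x) = (\<Sum>b\<in>B. (c b * (b \<bullet> x)) *\<^sub>R b)"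
        using c by (subst f_def) (auto simp: mult.assoc[symmetric] less_imp_le intro!: sum.cong)
      then show ?thesis
        by (simp add: S eigenbasis_apply[OF eb])
    qed
    then show ?thesis
      by (simp add: matrix_eq matrix_vector_mul_assoc[symmetric])
  qed
  ultimately show thesis by (rule that)
qed

text \<open>With \<open>D = S - T\<close> we have \<open>S D + D T = 0\<close>, so an eigenvector \<open>v\<close> of \<open>D\<close> for \<open>\<mu>\<close> gives
  \<open>\<mu> \<langle>v, (S + T) v\<rangle> = 0\<close>.\<close>

lemma pd_sqrt_unique:
  fixes S T :: "real^'n^'n"
  assumes S: "pos_def S" and T: "pos_def T" and eq: "S ** S = T ** T"
  shows "S = T"
proof -
  have symS: "sym_mat S" and symT: "sym_mat T"
    using S T by (auto simp: pos_def_def)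
  have symD: "sym_mat (S - T)"
    using symS symT by (simp add: sym_mat_def transpose_def vec_eq_iff)
  obtain B c where eb: "eigenbasis (S - T) B c"
    using eigenbasis_exists[OF symD] .
  have "c b = 0" if b: "b \<in> B" for b
  proof -
    have Db: "S *v b - T *v b = c b *\<^sub>R b"
      using eigenbasis_eigen[OF eb b] by (simp add: matrix_vector_mult_diff_rdistrib)
    have "b \<noteq> 0"
      using eigenbasis_orthonormal[OF eb b b] by auto
    have "S *v (S *v b) = T *v (T *v b)"
      by (simp add: matrix_vector_mul_assoc eq)
    then have "(S *v b) \<bullet> (S *v b) = (T *v b) \<bullet> (T *v b)"
      by (simp add: sym_mat_inner[OF symS] sym_mat_inner[OF symT])
    then have "0 = (S *v b - T *v b) \<bullet> (S *v b + T *v b)"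
      by (simp add: inner_simps inner_commute)
    also have "\<dots> = c b * (b \<bullet> (S *v b) + b \<bullet> (T *v b))"
      by (simp add: Db inner_add_right distrib_left)
    finally show ?thesis
      using S T \<open>b \<noteq> 0\<close> by (smt (verit) mult_eq_0_iff pos_def_def)
  qed
  then have "(S - T) *v x = 0" for x
    by (simp add: eigenbasis_apply[OF eb])
  then show ?thesis
    by (simp add: matrix_eq matrix_vector_mult_diff_rdistrib)
qed

text \<open>Existence and uniqueness together justify the definite description in
  \<open>pd_sqrt\<close>.\<close>

lemma pd_sqrt:
  assumes "pos_def N"
  shows "pos_def (pd_sqrt N)" "pd_sqrt N ** pd_sqrt N = N"
proof -
  have "\<exists>!S. pos_def S \<and> S ** S = N"
    using pd_sqrt_exists[OF assms] pd_sqrt_unique by metis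
  then have "pos_def (pd_sqrt N) \<and> pd_sqrt N ** pd_sqrt N = N"
    unfolding pd_sqrt_def by (rule theI')
  then show "pos_def (pd_sqrt N)" "pd_sqrt N ** pd_sqrt N = N" by auto
qed

lemma pos_def_invertible:
  fixes S :: "real^'n^'n"
  assumes "pos_def S"
  shows "invertible S"
  using assms
  by (metis inner_zero_right invertible_left_inverse less_irrefl matrix_left_invertible_ker
      pos_def_def)

text \<open>The substitution \<open>x = R *v v\<close> turns the form of \<open>N\<close> into
  \<open>v \<bullet> v\<close> and that of \<open>M\<close> into the form of \<open>K\<close>, so
  every eigenvalue of \<open>K\<close> lies between \<open>l\<close> and \<open>u\<close>.\<close>

lemma rel_cond_num_le:
  fixes M N :: "real^'n^'n"
  assumes M: "sym_mat M" and N: "pos_def N" and l: "0 < l"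
    and lower: "\<And>x. l * (x \<bullet> (N *v x)) \<le> x \<bullet> (M *v x)"
    and upper: "\<And>x. x \<bullet> (M *v x) \<le> u * (x \<bullet> (N *v x))"
  shows "rel_cond_num M N \<le> u / l"
proof -
  define S where "S = pd_sqrt N"
  define R where "R = matrix_inv S"
  define K where "K = R ** M ** R"
  have S: "pos_def S" "S ** S = N"
    using pd_sqrt[OF N] by (auto simp: S_def)
  have symS: "sym_mat S"
    using S by (simp add: pos_def_def)
  \<comment> \<open>\<open>matrix_inv\<close> chooses some two-sided inverse; invertibility of
    \<open>S\<close> makes the choice proper.\<close>
  have SR: "S ** R = mat 1"
    using someI_ex[OF pos_def_invertible[OF S(1), unfolded invertible_def]]
    by (simp add: R_def matrix_inv_def)
  have SRx: "S *v (R *v x) = x" for x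
    by (simp add: matrix_vector_mul_assoc SR)
  have symR: "(R *v x) \<bullet> y = x \<bullet> (R *v y)" for x y
    by (metis SRx sym_mat_inner[OF symS])
  have Kx: "K *v x = R *v (M *v (R *v x))" for x
    by (simp add: K_def matrix_vector_mul_assoc matrix_mul_assoc)
  have symK: "sym_mat K"
    by (rule sym_matI) (simp add: Kx symR sym_mat_inner[OF M])
  have "l \<le> d \<and> d \<le> u" if d: "d \<in> eigenvalues K" for d
  proof -
    obtain v where v: "v \<noteq> 0" "K *v v = d *\<^sub>R v"
      using d by (auto simp: eigenvalues_def scalar_mult_eq_scaleR)
    let ?x = "R *v v"
    have "?x \<bullet> (M *v ?x) = v \<bullet> (K *v v)"
      by (simp add: Kx symR)
    then have 1: "?x \<bullet> (M *v ?x) = d * (v \<bullet> v)"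
      by (simp add: v)
    have "?x \<bullet> (N *v ?x) = (S *v ?x) \<bullet> (S *v ?x)"
      by (simp add: S(2)[symmetric] matrix_vector_mul_assoc[symmetric] sym_mat_inner[OF symS])
    then have 2: "?x \<bullet> (N *v ?x) = v \<bullet> v"
      by (simp add: SRx)
    from lower[of ?x] upper[of ?x] show ?thesis
      unfolding 1 2 using v(1) by (simp add: mult_le_cancel_right)
  qed
  then have "l \<le> lambda_min K" "lambda_max K \<le> u" and "lambda_max K \<in> eigenvalues K"
    using sym_mat_eigenvalues[OF symK] by (auto simp: lambda_min_def lambda_max_def)
  \<comment> \<open>This sign ensures that the quotient does not decrease when the denominator
    \<open>lambda_min K\<close> is replaced by the smaller \<open>l\<close>.\<close>
  moreover from this have "0 \<le> lambda_max K"
    using \<open>\<And>d. d \<in> eigenvalues K \<Longrightarrow> l \<le> d \<and> d \<le> u\<close> l by force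
  ultimately have "cond_num K \<le> u / l"
    unfolding cond_num_def using l by (intro frac_le) auto
  then show ?thesis
    by (simp add: rel_cond_num_def pd_inv_sqrt_def K_def R_def S_def)
qed

section \<open>The Frobenius inner product and Kronecker products\<close>

text \<open>The inner product of type \<open>real^'n^'m\<close> is the Frobenius inner product.\<close>

lemma inner_transpose_transpose:
  fixes X Y :: "real^'n^'m"
  shows "transpose X \<bullet> transpose Y = X \<bullet> Y"
  unfolding inner_vec_def transpose_def by (subst sum.swap) simp

text \<open>Left multiplication acts on each column separately, so this reduces adjointness and
  spectral bounds for matrices to those for vectors.\<close>

lemma inner_matrix_columns:
  fixes X Y :: "real^'n^'m"
  shows "X \<bullet> Y = (\<Sum>j\<in>UNIV. column j X \<bullet> column j Y)"
  unfolding inner_vec_def column_def by (subst sum.swap) simp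

lemma column_matrix_mult:
  "column j (A ** B) = A *v column j B"
  by (simp add: column_def matrix_matrix_mult_def matrix_vector_mult_def vec_eq_iff)

lemma inner_matrix_mult_left:
  fixes A :: "real^'n^'m" and X :: "real^'k^'n"
  shows "(A ** X) \<bullet> Y = X \<bullet> (transpose A ** Y)"
proof -
  have "(A *v x) \<bullet> y = x \<bullet> (transpose A *v y)" for x y
    by (metis inner_commute inner_transpose_matrix_vector)
  then show ?thesis
    by (simp add: inner_matrix_columns column_matrix_mult del: transpose_matrix_vector)
qed

lemma inner_matrix_mult_right:
  fixes X :: "real^'n^'m" and A :: "real^'k^'n"
  shows "(X ** A) \<bullet> Y = X \<bullet> (Y ** transpose A)"
proof -
  have "(X ** A) \<bullet> Y = (transpose A ** transpose X) \<bullet> transpose Y"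
    by (simp add: inner_transpose_transpose flip: matrix_transpose_mul)
  also have "\<dots> = transpose X \<bullet> (A ** transpose Y)"
    by (simp add: inner_matrix_mult_left)
  also have "A ** transpose Y = transpose (Y ** transpose A)"
    by (simp add: matrix_transpose_mul)
  finally show ?thesis
    by (simp only: inner_transpose_transpose)
qed

lemma inner_vectorize:
  "vectorize X \<bullet> vectorize Y = X \<bullet> Y"
  by (simp add: inner_vec_def vectorize_def sum.cartesian_product case_prod_unfold)

lemma transpose_kron:
  "transpose (A \<otimes>\<^sub>K B) = transpose A \<otimes>\<^sub>K transpose B"
  by (simp add: kron_def transpose_def vec_eq_iff)

lemma lambda_bounds_matrix:
  fixes M :: "real^'n^'n" and X :: "real^'k^'n"
  assumes "sym_mat M"
  shows "lambda_min M * (X \<bullet> X) \<le> X \<bullet> (M ** X)" "X \<bullet> (M ** X) \<le> lambda_max M * (X \<bullet> X)"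
  unfolding inner_matrix_columns column_matrix_mult sum_distrib_left
  by (intro sum_mono lambda_bounds assms)+

text \<open>With \<open>S\<close> the root of \<open>M\<close> and \<open>Y = X ** S\<close>, the
  form is \<open>Y \<bullet> (M ** Y)\<close>, and \<open>Y \<bullet> Y\<close> is the one-sided
  form of \<open>M\<close> at \<open>transpose X\<close>. Two one-sided bounds give the
  squares.\<close>

lemma lambda_bounds_two_sided:
  fixes M X :: "real^'n^'n"
  assumes M: "pos_def M"
  shows "(lambda_min M)\<^sup>2 * (X \<bullet> X) \<le> X \<bullet> (M ** X ** M)"
    "X \<bullet> (M ** X ** M) \<le> (lambda_max M)\<^sup>2 * (X \<bullet> X)"
proof -
  obtain S where S: "pos_def S" "S ** S = M"
    using pd_sqrt_exists[OF M] .
  have symM: "sym_mat M" and tS: "transpose S = S"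
    using M S(1) by (auto simp: pos_def_def sym_mat_def)
  note b = lambda_bounds_matrix[OF symM]
  let ?Y = "X ** S"
  have 1: "X \<bullet> (M ** X ** M) = ?Y \<bullet> (M ** ?Y)"
    by (simp add: inner_matrix_mult_right tS S(2)[symmetric] matrix_mul_assoc)
  have "?Y \<bullet> ?Y = X \<bullet> (X ** M)"
    by (simp add: inner_matrix_mult_right tS S(2)[symmetric] matrix_mul_assoc)
  also have "\<dots> = transpose X \<bullet> (M ** transpose X)"
    using symM inner_transpose_transpose[of X "X ** M"]
    by (simp add: matrix_transpose_mul sym_mat_def)
  finally have 2: "lambda_min M * (X \<bullet> X) \<le> ?Y \<bullet> ?Y" "?Y \<bullet> ?Y \<le> lambda_max M * (X \<bullet> X)"
    using b[of "transpose X"] by (simp_all add: inner_transpose_transpose)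
  \<comment> \<open>Both extreme eigenvalues multiply a bound on \<open>?Y \<bullet> ?Y\<close>,
    hence their signs are needed.\<close>
  have "0 < lambda_min M"
    by (rule lambda_min_pos[OF M])
  moreover from this have "0 < lambda_max M"
    using M sym_mat_eigenvalues[OF symM] pos_def_eigenvalue_pos[OF M]
    by (simp add: lambda_max_def)
  ultimately show "(lambda_min M)\<^sup>2 * (X \<bullet> X) \<le> X \<bullet> (M ** X ** M)"
    "X \<bullet> (M ** X ** M) \<le> (lambda_max M)\<^sup>2 * (X \<bullet> X)"
    unfolding 1 power2_eq_square mult.assoc
    using b[of ?Y] 2 by (meson less_imp_le mult_left_mono order_trans)+
qed

section \<open>Comparison of the quadratic forms of \<open>H\<close> and \<open>H'\<close>\<close>

lemma matrix_add_rdistrib: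
  fixes B C :: "real^'n^'m" and A :: "real^'k^'n"
  shows "(B + C) ** A = B ** A + C ** A"
  by (simp add: matrix_matrix_mult_def vec_eq_iff distrib_right sum.distrib)

lemma vec_columns_mult:
  "vec_columns A *v v = vectorize (\<Sum>j\<in>UNIV. v $ j *\<^sub>R A j)"
  by (simp add: vec_columns_def vectorize_def matrix_vector_mult_def vec_eq_iff mult.commute)

lemma lin_indep_columns_ker:
  assumes "lin_indep_columns M" "M *v v = 0"
  shows "v = 0"
  using assms by (simp add: lin_indep_columns_def matrix_mult_sum vec_eq_iff)

theorem lemma7:
  fixes A :: "'m::finite \<Rightarrow> real^'n^'n"
    and W W0 :: "real^'n^'n"
    and U :: "real^'k^'n"
    and Z :: "real^'p^'n"
    and \<tau> :: real
    and AA :: "real^'m^('n \<times> 'n)"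
    and H H' :: "real^'m^'m"
    and UU :: "real^('k \<times> 'p)^'m"
  assumes "\<And>i. sym_mat (A i)"
    and "AA = vec_columns A"
    and "lin_indep_columns AA"
    and "pos_def W0"
    and "W = W0 + U ** transpose U"
    and "Z ** transpose Z = 2 *\<^sub>R W0 + U ** transpose U"
    and "lambda_min W0 \<le> \<tau>" and "\<tau> \<le> lambda_max W0"
    and "H = transpose AA ** (W \<otimes>\<^sub>K W) ** AA"
    and "UU = transpose AA ** (U \<otimes>\<^sub>K Z)"
    and "H' = \<tau>\<^sup>2 *\<^sub>R (transpose AA ** AA) + UU ** transpose UU"
  shows "rel_cond_num H H' \<le> (cond_num W0)\<^sup>2"
proof -
  define P where "P = U ** transpose U"
  define X where "X v = (\<Sum>j\<in>UNIV. v $ j *\<^sub>R A j)" for v :: "real^'m"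
  define s where "s v = (norm (transpose UU *v v))\<^sup>2" for v
  let ?l = "lambda_min W0" and ?u = "lambda_max W0"
  have lpos: "0 < ?l" and tpos: "0 < \<tau>"
    using lambda_min_pos[OF assms(4)] assms(7) by auto
  have tW0: "transpose W0 = W0"
    using assms(4) by (simp add: pos_def_def sym_mat_def)
  have tP: "transpose P = P"
    by (simp add: P_def matrix_transpose_mul)
  have W: "W = W0 + P"
    by (simp add: assms(5) P_def)
  have tadd: "transpose (Y + Y') = transpose Y + transpose Y'" for Y Y' :: "real^'a^'b"
    by (simp add: transpose_def vec_eq_iff)
  have tW: "transpose W = W"
    by (simp add: W tadd tW0 tP)
  have AAv: "AA *v v = vectorize (X v)" for v
    by (simp add: assms(2) X_def vec_columns_mult)
  have tX: "transpose (X v) = X v" for v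
    using assms(1) by (simp add: X_def sym_mat_def transpose_def vec_eq_iff)
  have Hx: "H *v y = transpose AA *v ((W \<otimes>\<^sub>K W) *v (AA *v y))" for y
    by (simp add: assms(9) matrix_vector_mul_assoc matrix_mul_assoc del: transpose_matrix_vector)
  have inAA: "x \<bullet> (transpose AA *v y) = (AA *v x) \<bullet> y" for x y
    by (metis inner_commute inner_transpose_matrix_vector)
  have symH: "sym_mat H"
    by (simp add: sym_mat_def assms(9) matrix_transpose_mul transpose_kron tW matrix_mul_assoc)
  have s_eq: "s v = X v \<bullet> (P ** X v ** (2 *\<^sub>R W0 + P))" for v
  proof -
    have "transpose UU *v v = (transpose U \<otimes>\<^sub>K transpose Z) *v (AA *v v)"
      by (simp add: assms(10) matrix_transpose_mul transpose_kron matrix_vector_mul_assoc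
          del: transpose_matrix_vector)
    \<comment> \<open>The right Kronecker factor is \<open>transpose Z\<close>, whose transpose
      restores \<open>Z\<close>.\<close>
    also have "\<dots> = vectorize (transpose U ** X v ** Z)"
      using vectorize_kron[of "transpose U" "X v" "transpose Z"] by (simp add: AAv)
    finally have "s v = (transpose U ** X v ** Z) \<bullet> (transpose U ** X v ** Z)"
      by (simp add: s_def power2_norm_eq_inner inner_vectorize del: transpose_matrix_vector)
    also have "\<dots> = X v \<bullet> (U ** transpose U ** X v ** (Z ** transpose Z))"
      by (simp add: inner_matrix_mult_right[of "transpose U ** X v" Z]
          inner_matrix_mult_left[of "transpose U" "X v"] matrix_mul_assoc)
    finally show ?thesis
      by (simp add: assms(6) P_def)
  qed
  have formH: "v \<bullet> (H *v v) = X v \<bullet> (W0 ** X v ** W0) + s v" for v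
  proof -
    have "v \<bullet> (H *v v) = X v \<bullet> (W ** X v ** W)"
      unfolding Hx inAA AAv using vectorize_kron[of W "X v" W]
      by (metis inner_vectorize tW)
    \<comment> \<open>Transposition exchanges the mixed terms of \<open>W ** X v ** W\<close>
      because \<open>X v\<close> is symmetric; together they account for the 2 in
      \<open>2 *\<^sub>R W0\<close>.\<close>
    moreover have "X v \<bullet> (W0 ** X v ** P) = X v \<bullet> (P ** X v ** W0)"
      using inner_transpose_transpose[of "X v" "W0 ** X v ** P"]
      by (simp add: matrix_transpose_mul tX tW0 tP matrix_mul_assoc)
    ultimately show ?thesis
      by (simp only: s_eq W matrix_add_ldistrib matrix_add_rdistrib inner_add_right scaleR_2)
  qed
  have formH': "v \<bullet> (H' *v v) = \<tau>\<^sup>2 * (X v \<bullet> X v) + s v" for v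
  proof -
    have "v \<bullet> ((transpose AA ** AA) *v v) = X v \<bullet> X v"
      by (simp add: matrix_vector_mul_assoc[symmetric] inAA AAv inner_vectorize
          del: transpose_matrix_vector)
    moreover have "v \<bullet> ((UU ** transpose UU) *v v) = s v"
      by (metis inner_transpose_matrix_vector matrix_vector_mul_assoc power2_norm_eq_inner s_def)
    ultimately show ?thesis
      by (simp add: assms(11) matrix_vector_mult_add_rdistrib inner_add_right
          scaleR_matrix_vector_assoc[symmetric])
  qed
  have s0: "0 \<le> s v" for v
    by (simp add: s_def)
  have "pos_def H'"
  proof -
    have "transpose H' = H'"
      by (simp add: assms(11) tadd transpose_scalar matrix_transpose_mul)
    moreover have "0 < v \<bullet> (H' *v v)" if "v \<noteq> 0" for v
    proof -
      \<comment> \<open>Independence of the columns enters here; since \<open>vectorize\<close>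
        preserves inner products, \<open>X v\<close> is nonzero too.\<close>
      have "AA *v v \<noteq> 0"
        using lin_indep_columns_ker[OF assms(3)] that by blast
      then have "0 < X v \<bullet> X v"
        unfolding AAv by (metis inner_gt_zero_iff inner_vectorize)
      then show ?thesis
        using tpos s0[of v] by (simp add: formH' add_pos_nonneg)
    qed
    ultimately show ?thesis
      by (simp add: pos_def_def sym_mat_def)
  qed
  moreover have "(?l / \<tau>)\<^sup>2 * (v \<bullet> (H' *v v)) \<le> v \<bullet> (H *v v)" for v
  proof -
    \<comment> \<open>The factor turns \<open>\<tau>\<^sup>2\<close> into \<open>?l\<^sup>2\<close>
      in the first term of the form of \<open>H'\<close>; being at most 1, it does not enlarge the
      shared term \<open>s v\<close>.\<close>
    have "(?l / \<tau>)\<^sup>2 * s v \<le> 1 * s v"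
      using assms(7) lpos tpos s0 by (intro mult_right_mono power_le_one) auto
    then show ?thesis
      using lambda_bounds_two_sided(1)[OF assms(4), of "X v"] tpos
      by (simp add: formH formH' distrib_left power_divide)
  qed
  moreover have "v \<bullet> (H *v v) \<le> (?u / \<tau>)\<^sup>2 * (v \<bullet> (H' *v v))" for v
  proof -
    have "1 * s v \<le> (?u / \<tau>)\<^sup>2 * s v"
      using assms(8) tpos s0 by (intro mult_right_mono one_le_power) auto
    then show ?thesis
      using lambda_bounds_two_sided(2)[OF assms(4), of "X v"] tpos
      by (simp add: formH formH' distrib_left power_divide)
  qed
  ultimately have "rel_cond_num H H' \<le> (?u / \<tau>)\<^sup>2 / (?l / \<tau>)\<^sup>2"
    using symH lpos tpos by (intro rel_cond_num_le) auto
  also have "\<dots> = (cond_num W0)\<^sup>2"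
    using tpos by (simp add: cond_num_def power_divide)
  finally show ?thesis .
qed

end
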